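(* Let $\Sigma$ be an $n\times n$ symmetric positive definite real matrix and let $\pi=\mathcal{N}(0,\Sigma)$ be the centered Gaussian distribution on $\mathbb{R}^n$ with covariance $\Sigma$. Let $\mathcal{M}^+_\Sigma$ be the set of all $n\times n$ symmetric positive definite real matrices that commute with $\Sigma$. For $M\in\mathcal{M}^+_\Sigma$ and $T>0$, let $\mathbf{x}_0\sim\pi$ and $\mathbf{p}_0\sim\mathcal{N}(0,M)$ be independent, let $(\mathbf{x}(t),\mathbf{p}(t))$ be the exact solution of the Hamiltonian system $$\frac{d\mathbf{x}}{dt}=\frac{\partial H}{\partial \mathbf{p}},\qquad \frac{d\mathbf{p}}{dt}=-\frac{\partial H}{\partial \mathbf{x}},\qquad H(\mathbf{x},\mathbf{p})=U(\mathbf{x})+K(\mathbf{p}),$$ with $U(\mathbf{x})=-\log\pi(\mathbf{x})$, $K(\mathbf{p})=\tfrac12\mathbf{p}^{T}M^{-1}\mathbf{p}$ and initial condition $(\mathbf{x}(0),\mathbf{p}(0))=(\mathbf{x}_0,\mathbf{p}_0)$, and put $\mathbf{x}_T=\mathbf{x}(T)$. Then, for every non-negative integer $m$, the pair $$M=\Sigma^{-1},\qquad T=\frac{(2m+1)\pi}{2}$$ is a solution (a maximizer) of the optimization problem $$\max_{M\in\mathcal{M}^+_\Sigma,\;T\in(0,\infty)}\ \mathbb{E}_{\mathbf{x}_0}\big[\log\det\mathrm{Cov}[\mathbf{x}_T\mid\mathbf{x}_0]\big].$$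
   Context: Here $\pi(\mathbf{x})$ also denotes the density of the distribution $\pi$ on $\mathbb{R}^n$. $\mathrm{Cov}[\mathbf{x}_T\mid\mathbf{x}_0]$ is the conditional covariance matrix of $\mathbf{x}_T$ given $\mathbf{x}_0$ (the randomness being that of $\mathbf{p}_0$), and $\mathbb{E}_{\mathbf{x}_0}$ is the expectation over $\mathbf{x}_0\sim\pi$. The convention $\log 0=-\infty$ is used when the conditional covariance is singular. *)

theory Defs
  imports "HOL-Probability.Probability"
begin

definition sym_pos_def :: "real^'n^'n \<Rightarrow> bool" where
  "sym_pos_def S \<longleftrightarrow> transpose S = S \<and> (\<forall>v. v \<noteq> 0 \<longrightarrow> 0 < v \<bullet> (S *v v))"

definition commuting_spd :: "real^'n^'n \<Rightarrow> (real^'n^'n) set" where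
  "commuting_spd S = {M. sym_pos_def M \<and> M ** S = S ** M}"

text \<open>Density of the centered Gaussian with covariance matrix \<open>S\<close>; meaningful only for
  symmetric positive definite \<open>S\<close>.\<close>

definition gaussian_density :: "real^'n^'n \<Rightarrow> real^'n \<Rightarrow> real" where
  "gaussian_density S x =
     exp (- (x \<bullet> (matrix_inv S *v x)) / 2) / sqrt ((2 * pi) ^ CARD('n) * det S)"

definition gaussian_rv :: "'w measure \<Rightarrow> real^'n^'n \<Rightarrow> ('w \<Rightarrow> real^'n) \<Rightarrow> bool" where
  "gaussian_rv P S X \<longleftrightarrow> distributed P lborel X (\<lambda>x. ennreal (gaussian_density S x))"

definition initial_state ::
    "real^'n^'n \<Rightarrow> real^'n^'n \<Rightarrow> 'w measure \<Rightarrow> ('w \<Rightarrow> real^'n) \<Rightarrow> ('w \<Rightarrow> real^'n) \<Rightarrow> bool" where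
  "initial_state S M P x0 p0 \<longleftrightarrow>
     prob_space P \<and> gaussian_rv P S x0 \<and> gaussian_rv P M p0 \<and>
     prob_space.indep_var P borel x0 borel p0"

definition potential :: "real^'n^'n \<Rightarrow> real^'n \<Rightarrow> real" where
  "potential S x = - ln (gaussian_density S x)"

definition kinetic :: "real^'n^'n \<Rightarrow> real^'n \<Rightarrow> real" where
  "kinetic M p = (p \<bullet> (matrix_inv M *v p)) / 2"

definition hamiltonian :: "real^'n^'n \<Rightarrow> real^'n^'n \<Rightarrow> real^'n \<Rightarrow> real^'n \<Rightarrow> real" where
  "hamiltonian S M x p = potential S x + kinetic M p"

definition hamiltonian_solution ::
    "('v::real_inner \<Rightarrow> 'v \<Rightarrow> real) \<Rightarrow> 'v \<Rightarrow> 'v \<Rightarrow> (real \<Rightarrow> 'v \<times> 'v) \<Rightarrow> bool" where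
  "hamiltonian_solution H x0 p0 z \<longleftrightarrow> z 0 = (x0, p0) \<and>
     (\<forall>t. \<exists>gx gp. GDERIV (\<lambda>x. H x (snd (z t))) (fst (z t)) :> gx \<and>
                 GDERIV (\<lambda>p. H (fst (z t)) p) (snd (z t)) :> gp \<and>
                 (z has_vector_derivative (gp, - gx)) (at t))"

text \<open>Solutions are taken on the whole time axis so that the solution, as a function on
  \<open>real\<close>, is unique.\<close>

definition hamiltonian_flow ::
    "('v::real_inner \<Rightarrow> 'v \<Rightarrow> real) \<Rightarrow> 'v \<Rightarrow> 'v \<Rightarrow> real \<Rightarrow> 'v \<times> 'v" where
  "hamiltonian_flow H x0 p0 = (THE z. hamiltonian_solution H x0 p0 z)"

definition position_at ::
    "real^'n^'n \<Rightarrow> real^'n^'n \<Rightarrow> real \<Rightarrow> real^'n \<Rightarrow> real^'n \<Rightarrow> real^'n" where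
  "position_at S M T x0 p0 = fst (hamiltonian_flow (hamiltonian S M) x0 p0 T)"

definition cond_cov ::
    "'w measure \<Rightarrow> 'w measure \<Rightarrow> ('w \<Rightarrow> real^'n) \<Rightarrow> 'w \<Rightarrow> real^'n^'n" where
  "cond_cov P F X w =
     (\<chi> i j. real_cond_exp P F
        (\<lambda>v. (X v $ i - real_cond_exp P F (\<lambda>u. X u $ i) v) *
             (X v $ j - real_cond_exp P F (\<lambda>u. X u $ j) v)) w)"

definition cond_cov_given ::
    "'w measure \<Rightarrow> ('w \<Rightarrow> real^'n) \<Rightarrow> ('w \<Rightarrow> real^'n) \<Rightarrow> 'w \<Rightarrow> real^'n^'n" where
  "cond_cov_given P X Y = cond_cov P (vimage_algebra (space P) Y borel) X"

text \<open>The value \<open>-\<infinity>\<close> for negative arguments plays no role: covariance matrices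
  have nonnegative determinant.\<close>

definition log_ereal :: "real \<Rightarrow> ereal" where
  "log_ereal r = (if 0 < r then ereal (ln r) else - \<infinity>)"

text \<open>Expectation of an extended real random variable: the integral of the positive part minus
  the integral of the negative part (\<open>e2ennreal\<close> truncates negative values to 0).
  It is the usual one when at least one of the two parts has finite integral.\<close>

definition ereal_expectation :: "'w measure \<Rightarrow> ('w \<Rightarrow> ereal) \<Rightarrow> ereal" where
  "ereal_expectation P f =
     enn2ereal (\<integral>\<^sup>+ w. e2ennreal (f w) \<partial>P) - enn2ereal (\<integral>\<^sup>+ w. e2ennreal (- f w) \<partial>P)"

definition expected_log_det_cov ::
    "real^'n^'n \<Rightarrow> real^'n^'n \<Rightarrow> real \<Rightarrow> 'w measure \<Rightarrow> ('w \<Rightarrow> real^'n) \<Rightarrow> ('w \<Rightarrow> real^'n) \<Rightarrow> ereal"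
  where
  "expected_log_det_cov S M T P x0 p0 =
     ereal_expectation P
       (\<lambda>w. log_ereal (det (cond_cov_given P (\<lambda>v. position_at S M T (x0 v) (p0 v)) x0 w)))"

end

theory Submission
  imports Defs
begin

text \<open>The flow is linear in the initial data, so \<open>x\<^sub>T = D x\<^sub>0 + C p\<^sub>0\<close> and
  the conditional covariance is the constant \<open>C M C\<^sup>T\<close>. Conservation of energy from
  \<open>x\<^sub>0 = 0\<close> says that \<open>C\<close> is a contraction from the inner product of
  \<open>M\<^sup>-\<^sup>1\<close> to that of \<open>\<Sigma>\<^sup>-\<^sup>1\<close>; composing it with its adjoint
  gives a contraction of determinant \<open>det (C M C\<^sup>T) / det \<Sigma>\<close>, so
  \<open>det (C M C\<^sup>T) \<le> det \<Sigma>\<close> without any diagonalisation. For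
  \<open>M = \<Sigma>\<^sup>-\<^sup>1\<close> one has \<open>C = sin T \<Sigma>\<close>, and the bound is attained as
  soon as \<open>sin T = \<plusminus>1\<close>.\<close>

section \<open>Inner products given by positive definite matrices\<close>

lemma sym_pos_def_inner_commute:
  assumes "sym_pos_def S"
  shows "x \<bullet> (S *v y) = (S *v x) \<bullet> y"
  using assms unfolding sym_pos_def_def
  by (metis dot_lmul_matrix vector_transpose_matrix)

lemma sym_pos_def_nonneg:
  assumes "sym_pos_def S"
  shows "0 \<le> x \<bullet> (S *v x)"
  using assms unfolding sym_pos_def_def by (cases "x = 0") (auto intro: less_imp_le)

lemma sym_pos_def_eq_0:
  assumes "sym_pos_def S" "x \<bullet> (S *v x) \<le> 0"
  shows "x = 0"
  using assms unfolding sym_pos_def_def by force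

text \<open>The form is nonnegative at \<open>x - (b / c) *\<^sub>R y\<close>, the part of
  \<open>x\<close> orthogonal to \<open>y\<close> for this inner product, and its value there is
  \<open>a - b\<^sup>2 / c\<close>.\<close>

lemma sym_pos_def_Cauchy_Schwarz:
  assumes "sym_pos_def S"
  shows "(x \<bullet> (S *v y))\<^sup>2 \<le> (x \<bullet> (S *v x)) * (y \<bullet> (S *v y))"
proof (cases "y = 0")
  case False
  define a where "a = x \<bullet> (S *v x)"
  define b where "b = x \<bullet> (S *v y)"
  define c where "c = y \<bullet> (S *v y)"
  have c: "0 < c"
    using assms False by (simp add: sym_pos_def_def c_def)
  have "y \<bullet> (S *v x) = b"
    by (metis assms b_def inner_commute sym_pos_def_inner_commute)
  then have "(x - (b / c) *\<^sub>R y) \<bullet> (S *v (x - (b / c) *\<^sub>R y)) = a - 2 * (b / c) * b + (b / c)\<^sup>2 * c"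
    by (simp add: a_def b_def c_def matrix_vector_mult_diff_distrib matrix_vector_mult_scaleR
        inner_diff_left inner_diff_right power2_eq_square algebra_simps)
  also have "\<dots> = a - b\<^sup>2 / c"
    using c by (simp add: field_simps power2_eq_square)
  finally have "0 \<le> a - b\<^sup>2 / c"
    using sym_pos_def_nonneg[OF assms] by metis
  then show ?thesis
    using c unfolding a_def[symmetric] b_def[symmetric] c_def[symmetric] by (simp add: field_simps)
qed simp

lemma sym_pos_def_invertible:
  assumes "sym_pos_def S"
  shows "invertible S"
proof -
  have "inj ((*v) S)"
    by (metis assms inner_zero_right matrix_left_invertible_injective matrix_left_invertible_ker
        order_refl sym_pos_def_eq_0)
  then show ?thesis
    by (metis invertible_left_inverse matrix_left_invertible_injective)
qed

lemma invertible_matrix_inv: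
  fixes S :: "real^'n^'n"
  assumes "invertible S"
  shows "S ** matrix_inv S = mat 1" "matrix_inv S ** S = mat 1"
proof -
  have "S ** matrix_inv S = mat 1 \<and> matrix_inv S ** S = mat 1"
    unfolding matrix_inv_def by (rule someI_ex) (use assms in \<open>simp add: invertible_def\<close>)
  then show "S ** matrix_inv S = mat 1" "matrix_inv S ** S = mat 1"
    by simp_all
qed

lemma sym_pos_def_mult_inv [simp]:
  assumes "sym_pos_def S"
  shows "S ** matrix_inv S = mat 1" "matrix_inv S ** S = mat 1"
    "S *v (matrix_inv S *v x) = x" "matrix_inv S *v (S *v x) = x"
  using invertible_matrix_inv[OF sym_pos_def_invertible[OF assms]]
  by (simp_all add: matrix_vector_mul_assoc)

text \<open>With \<open>v = S *v u\<close>, the form of the inverse at \<open>v\<close> becomes the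
  form of \<open>S\<close> at \<open>u\<close>.\<close>

lemma sym_pos_def_matrix_inv:
  assumes "sym_pos_def S"
  shows "sym_pos_def (matrix_inv S)"
  unfolding sym_pos_def_def
proof (intro conjI allI impI)
  have "transpose (matrix_inv S) ** S = mat 1"
    using arg_cong[OF sym_pos_def_mult_inv(1)[OF assms], of transpose] assms
    by (simp add: matrix_transpose_mul transpose_mat sym_pos_def_def)
  then show "transpose (matrix_inv S) = matrix_inv S"
    by (metis assms matrix_mul_assoc matrix_mul_lid matrix_mul_rid sym_pos_def_mult_inv(1))
next
  fix v :: "real^'a" assume v: "v \<noteq> 0"
  define u where "u = matrix_inv S *v v"
  have "v = S *v u"
    using assms by (simp add: u_def)
  then have "0 < u \<bullet> (S *v u)"
    using v assms by (metis matrix_vector_mult_0_right sym_pos_def_def)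
  then show "0 < v \<bullet> (matrix_inv S *v v)"
    unfolding u_def[symmetric] by (metis \<open>v = S *v u\<close> inner_commute)
qed

lemma matrix_inv_matrix_inv_sym_pos_def:
  assumes "sym_pos_def S"
  shows "matrix_inv (matrix_inv S) = S"
  by (metis assms matrix_mul_assoc matrix_mul_lid matrix_mul_rid sym_pos_def_matrix_inv
      sym_pos_def_mult_inv(1))

lemma matrix_inv_mem_commuting_spd:
  assumes "sym_pos_def S"
  shows "matrix_inv S \<in> commuting_spd S"
  using assms by (simp add: commuting_spd_def sym_pos_def_matrix_inv)

section \<open>Determinants of contractions and of positive definite matrices\<close>

text \<open>A crude bound from the Leibniz formula: each of the \<open>n!\<close> terms is at most
  \<open>K ^ n\<close>. It suffices because only boundedness along the powers of a matrix
  matters.\<close>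

lemma abs_det_le:
  fixes A :: "real^'n^'n"
  assumes "\<And>i j. \<bar>A $ i $ j\<bar> \<le> K"
  shows "\<bar>det A\<bar> \<le> fact CARD('n) * K ^ CARD('n)"
proof -
  have "\<bar>det A\<bar> \<le> (\<Sum>p | p permutes (UNIV :: 'n set). \<bar>of_int (sign p) * (\<Prod>i\<in>UNIV. A $ i $ p i)\<bar>)"
    unfolding det_def by (rule sum_abs)
  also have "\<dots> \<le> (\<Sum>p | p permutes (UNIV :: 'n set). K ^ CARD('n))"
  proof (rule sum_mono)
    fix p :: "'n \<Rightarrow> 'n"
    have "(\<Prod>i\<in>UNIV. \<bar>A $ i $ p i\<bar>) \<le> (\<Prod>i\<in>(UNIV :: 'n set). K)"
      by (rule prod_mono) (use assms in auto)
    then show "\<bar>of_int (sign p) * (\<Prod>i\<in>UNIV. A $ i $ p i)\<bar> \<le> K ^ CARD('n)"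
      by (simp add: abs_mult abs_prod sign_def)
  qed
  also have "\<dots> = fact CARD('n) * K ^ CARD('n)"
    by (simp add: card_permutations[OF refl])
  finally show ?thesis .
qed

text \<open>The powers of a contraction for an inner product have bounded entries, so the powers of its
  determinant are bounded.\<close>

lemma abs_det_le_1_of_contraction:
  fixes B Q :: "real^'n^'n"
  assumes B: "sym_pos_def B"
    and Q: "\<And>x. (Q *v x) \<bullet> (B *v (Q *v x)) \<le> x \<bullet> (B *v x)"
  shows "\<bar>det Q\<bar> \<le> 1"
proof -
  \<comment> \<open>\<open>R k\<close> is the \<open>k\<close>-th power of \<open>Q\<close> for the
    matrix product.\<close>
  define R where "R k = ((\<lambda>X. Q ** X) ^^ k) (mat 1)" for k
  have R_Suc: "R (Suc k) = Q ** R k" for k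
    by (simp add: R_def)
  have det_R: "det (R k) = det Q ^ k" for k
    by (induction k) (simp_all add: R_Suc det_mul, simp add: R_def)
  have contr: "(R k *v x) \<bullet> (B *v (R k *v x)) \<le> x \<bullet> (B *v x)" for k x
  proof (induction k)
    case (Suc k)
    then show ?case
      using Q[of "R k *v x"] by (simp add: R_Suc matrix_vector_mul_assoc[symmetric])
  qed (simp add: R_def)
  define q where "q x = x \<bullet> (B *v x)" for x
  \<comment> \<open>Writing \<open>axis i 1\<close> as \<open>B\<close> applied to
    \<open>matrix_inv B *v axis i 1\<close> turns an entry of \<open>R k\<close> into a
    \<open>B\<close>-inner product. Cauchy-Schwarz and the contraction property bound it by this
    maximum, which does not depend on \<open>k\<close>.\<close>
  define K where "K = Max (range (\<lambda>(i, j). sqrt (q (matrix_inv B *v axis i 1) * q (axis j 1))))"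
  have entry: "\<bar>R k $ i $ j\<bar> \<le> K" for k i j
  proof -
    have "R k $ i $ j = axis i 1 \<bullet> (R k *v axis j 1)"
      by (simp add: matrix_vector_mult_basis inner_axis' column_def)
    also have "\<dots> = (matrix_inv B *v axis i 1) \<bullet> (B *v (R k *v axis j 1))"
      using B by (simp add: sym_pos_def_inner_commute)
    finally have "(R k $ i $ j)\<^sup>2 \<le> q (matrix_inv B *v axis i 1) * q (R k *v axis j 1)"
      using sym_pos_def_Cauchy_Schwarz[OF B] by (simp add: q_def)
    also have "\<dots> \<le> q (matrix_inv B *v axis i 1) * q (axis j 1)"
      using contr sym_pos_def_nonneg[OF B] by (intro mult_left_mono) (simp_all add: q_def)
    finally have "\<bar>R k $ i $ j\<bar> \<le> sqrt (q (matrix_inv B *v axis i 1) * q (axis j 1))"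
      by (rule real_le_rsqrt[of "\<bar>R k $ i $ j\<bar>", simplified])
    also have "\<dots> \<le> K"
      unfolding K_def by (rule Max_ge) (auto intro: image_eqI[of _ _ "(i, j)"])
    finally show ?thesis .
  qed
  have "\<bar>det Q\<bar> ^ k \<le> fact CARD('n) * K ^ CARD('n)" for k
    using abs_det_le[of "R k" K] entry by (simp add: det_R power_abs)
  \<comment> \<open>A number above 1 would have unbounded powers.\<close>
  then show ?thesis
    by (meson not_le real_arch_pow)
qed

text \<open>The product in the conclusion is the determinant of the adjoint of \<open>C\<close>
  times \<open>C\<close>, and such a composition contracts the form of \<open>B\<close>. To be
  applied with \<open>A\<close> and \<open>B\<close> the inverses of \<Sigma> and
  \<open>M\<close>.\<close>

lemma det_sandwich_le:
  fixes A B C :: "real^'n^'n"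
  assumes A: "sym_pos_def A" and B: "sym_pos_def B"
    and C: "\<And>x. (C *v x) \<bullet> (A *v (C *v x)) \<le> x \<bullet> (B *v x)"
  shows "\<bar>det (matrix_inv B) * det C * det A * det C\<bar> \<le> 1"
proof -
  define a where "a x = x \<bullet> (A *v x)" for x
  define b where "b x = x \<bullet> (B *v x)" for x
  define C' where "C' = matrix_inv B ** transpose C ** A"
  have nonneg: "0 \<le> a x" "0 \<le> b x" for x
    using A B by (simp_all add: a_def b_def sym_pos_def_nonneg)
  txt \<open>\<open>C'\<close> is the adjoint of \<open>C\<close> for the two inner products, hence a contraction as well.\<close>
  have adj: "u \<bullet> (A *v (C *v x)) = (C' *v u) \<bullet> (B *v x)" for u x
  proof -
    have "(C' *v u) \<bullet> (B *v x) = (transpose C *v (A *v u)) \<bullet> x"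
      using B by (simp add: C'_def matrix_vector_mul_assoc[symmetric] sym_pos_def_inner_commute)
    also have "\<dots> = (A *v u) \<bullet> (C *v x)"
      by (metis dot_lmul_matrix vector_transpose_matrix transpose_transpose)
    finally show ?thesis
      using A by (simp add: sym_pos_def_inner_commute)
  qed
  have C': "b (C' *v u) \<le> a u" for u
  proof -
    let ?v = "C' *v u"
    have "(b ?v)\<^sup>2 = (u \<bullet> (A *v (C *v ?v)))\<^sup>2"
      by (simp add: adj b_def)
    also have "\<dots> \<le> a u * a (C *v ?v)"
      unfolding a_def by (rule sym_pos_def_Cauchy_Schwarz[OF A])
    also have "\<dots> \<le> a u * b ?v"
      using C nonneg by (intro mult_left_mono) (simp_all add: a_def b_def)
    \<comment> \<open>One factor \<open>b ?v\<close> cancels; if it is zero, the claim is just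
      \<open>0 \<le> a u\<close>.\<close>
    finally show ?thesis
      using nonneg(1)[of u] nonneg(2)[of ?v]
      by (cases "b ?v = 0") (auto simp: power2_eq_square)
  qed
  have "\<bar>det (C' ** C)\<bar> \<le> 1"
  proof (rule abs_det_le_1_of_contraction[OF B])
    fix x
    have "b (C' *v (C *v x)) \<le> b x"
      using C'[of "C *v x"] C[of x] by (simp add: a_def b_def)
    then show "((C' ** C) *v x) \<bullet> (B *v ((C' ** C) *v x)) \<le> x \<bullet> (B *v x)"
      by (simp add: b_def matrix_vector_mul_assoc)
  qed
  then show ?thesis
    by (simp add: C'_def det_mul det_transpose mult_ac)
qed

text \<open>The segment from the identity to \<open>S\<close> consists of positive definite, hence
  invertible, matrices. A nonpositive \<open>det S\<close> would force the determinant to vanish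
  somewhere on it by the intermediate value theorem.\<close>

lemma sym_pos_def_det_pos:
  fixes S :: "real^'n^'n"
  assumes "sym_pos_def S"
  shows "0 < det S"
proof (rule ccontr)
  define G where "G s = (1 - s) *\<^sub>R mat 1 + s *\<^sub>R S" for s :: real
  assume "\<not> 0 < det S"
  then have "det (G 1) \<le> 0" "0 \<le> det (G 0)"
    by (simp_all add: G_def)
  moreover have "continuous_on {0..1} (\<lambda>s. det (G s))"
    unfolding det_def G_def by (intro continuous_intros)
  ultimately obtain s where s: "0 \<le> s" "s \<le> 1" "det (G s) = 0"
    using IVT2'[of "\<lambda>s. det (G s)" 1 0 0] by auto
  have "sym_pos_def (G s)"
    unfolding sym_pos_def_def
  proof (intro conjI allI impI)
    show "transpose (G s) = G s"
      using assms by (auto simp: sym_pos_def_def G_def vec_eq_iff transpose_def mat_def)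
    fix v :: "real^'n" assume "v \<noteq> 0"
    then have v: "0 < v \<bullet> v" "0 < v \<bullet> (S *v v)"
      using assms by (auto simp: sym_pos_def_def)
    have "v \<bullet> (G s *v v) = (1 - s) * (v \<bullet> v) + s * (v \<bullet> (S *v v))"
      by (simp add: G_def matrix_vector_mult_add_rdistrib scaleR_matrix_vector_assoc[symmetric]
          inner_add_right)
    \<comment> \<open>Either summand may vanish at an end of the segment, so strictness comes from
      the second one for positive \<open>s\<close> and from the first one at
      \<open>s = 0\<close>.\<close>
    moreover have "0 < (1 - s) * (v \<bullet> v) + s * (v \<bullet> (S *v v))"
    proof (cases "s = 0")
      case False
      then have "0 < s * (v \<bullet> (S *v v))" "0 \<le> (1 - s) * (v \<bullet> v)"
        using s v by simp_all
      then show ?thesis by linarith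
    qed (use v in simp)
    ultimately show "0 < v \<bullet> (G s *v v)" by simp
  qed
  then show False
    using s(3) sym_pos_def_invertible invertible_det_nz by blast
qed

section \<open>The Hamiltonian flow\<close>

text \<open>The solution is the exponential series of \<open>t L\<close> applied to
  \<open>z0\<close>. It is dominated by the series of \<open>exp (K * \<bar>t\<bar>)\<close> and
  differentiated coordinatewise as a real power series.\<close>

lemma linear_ode_solution_exists:
  fixes L :: "'a::euclidean_space \<Rightarrow> 'a"
  assumes "linear L"
  shows "\<exists>z. z 0 = z0 \<and> (\<forall>t. (z has_vector_derivative L (z t)) (at t))"
proof -
  have bl: "bounded_linear L"
    using assms by (rule linear_conv_bounded_linear[THEN iffD1])
  obtain K where K: "\<And>x. norm (L x) \<le> norm x * K" "0 \<le> K"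
    using bounded_linear.nonneg_bounded[OF bl] by blast
  have norm_pow: "norm ((L ^^ k) x) \<le> K ^ k * norm x" for k x
  proof (induction k)
    case (Suc k)
    have "norm (L ((L ^^ k) x)) \<le> norm ((L ^^ k) x) * K"
      by (rule K)
    also have "\<dots> \<le> (K ^ k * norm x) * K"
      using Suc K(2) by (rule mult_right_mono)
    finally show ?case by (simp add: mult_ac)
  qed simp
  define f where "f x t k = (t ^ k / fact k) *\<^sub>R (L ^^ k) x" for x and t :: real and k
  have summ: "summable (f x t)" for x t
  proof (rule summable_comparison_test')
    show "summable (\<lambda>k. norm x * (inverse (fact k) * (K * \<bar>t\<bar>) ^ k))"
      using summable_exp[of "K * \<bar>t\<bar>"] by (intro summable_mult)
    fix k :: nat
    have "norm (f x t k) = \<bar>t\<bar> ^ k / fact k * norm ((L ^^ k) x)"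
      by (simp add: f_def power_abs)
    also have "\<dots> \<le> \<bar>t\<bar> ^ k / fact k * (K ^ k * norm x)"
      by (intro mult_left_mono norm_pow) simp
    finally show "norm (f x t k) \<le> norm x * (inverse (fact k) * (K * \<bar>t\<bar>) ^ k)"
      by (simp add: power_mult_distrib field_simps)
  qed
  define z where "z t = suminf (f z0 t)" for t
  \<comment> \<open>Applying \<open>L\<close> termwise gives the same series started at
    \<open>L z0\<close>; the derivative below is recognised in this form.\<close>
  have Lz: "L (z t) = suminf (f (L z0) t)" for t
  proof -
    have "L (z t) = (\<Sum>k. L (f z0 t k))"
      unfolding z_def by (rule bounded_linear.suminf[OF bl summ])
    also have "(\<lambda>k. L (f z0 t k)) = f (L z0) t"
      by (simp add: f_def fun_eq_iff linear_scale[OF assms] funpow_swap1)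
    finally show ?thesis .
  qed
  have inner_sum: "suminf (f x t) \<bullet> b = (\<Sum>k. ((L ^^ k) x \<bullet> b / fact k) * t ^ k)" for x t b
    using bounded_linear.suminf[OF bounded_linear_inner_left summ, of x t b]
    by (simp add: f_def[abs_def] mult_ac)
  have deriv: "((\<lambda>t. z t \<bullet> b) has_field_derivative L (z t) \<bullet> b) (at t)" for t b
  proof -
    let ?c = "\<lambda>k. (L ^^ k) z0 \<bullet> b / fact k"
    have "((\<lambda>t. \<Sum>k. ?c k * t ^ k) has_field_derivative (\<Sum>k. diffs ?c k * t ^ k)) (at t)"
    proof (rule termdiffs_strong_converges_everywhere)
      show "summable (\<lambda>k. ?c k * y ^ k)" for y
        using bounded_linear.summable[OF bounded_linear_inner_left summ, of z0 y b]
        by (simp add: f_def mult_ac)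
    qed
    \<comment> \<open>The factor \<open>k + 1\<close> produced by differentiation cancels against
      the factorial, leaving one more application of \<open>L\<close>.\<close>
    moreover have "diffs ?c = (\<lambda>k. (L ^^ k) (L z0) \<bullet> b / fact k)"
      by (simp add: diffs_def fun_eq_iff funpow_swap1 del: of_nat_Suc)
    ultimately show ?thesis
      by (simp add: z_def Lz[unfolded z_def] inner_sum)
  qed
  have "(z has_vector_derivative L (z t)) (at t)" for t
    unfolding has_vector_derivative_def
  proof (subst has_derivative_componentwise_within, intro ballI)
    fix b :: 'a
    show "((\<lambda>x. z x \<bullet> b) has_derivative (\<lambda>x. (x *\<^sub>R L (z t)) \<bullet> b)) (at t)"
      by (rule has_derivative_eq_rhs[OF deriv[unfolded has_field_derivative_def]])
        (simp add: fun_eq_iff)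
  qed
  moreover have "z 0 = z0"
  proof -
    \<comment> \<open>Only the term with \<open>k = 0\<close> survives, because
      \<open>0 ^ 0 = 1\<close>.\<close>
    have "f z0 0 = (\<lambda>k. if k = 0 then z0 else 0)"
      by (auto simp: f_def)
    then show ?thesis
      using sums_unique[OF sums_single[of 0 "\<lambda>_. z0"]] by (simp add: z_def)
  qed
  ultimately show ?thesis by blast
qed

section \<open>Gradients of the potential and kinetic energies\<close>

text \<open>Allows the existentially quantified gradients in \<open>hamiltonian_solution\<close> to
  be replaced by explicit ones.\<close>

lemma GDERIV_unique:
  assumes "GDERIV f x :> a" "GDERIV f x :> b"
  shows "a = b"
proof -
  have "(\<lambda>h. h \<bullet> a) = (\<lambda>h. h \<bullet> b)"
    using assms unfolding gderiv_def by (rule has_derivative_unique)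
  then have "\<forall>h. h \<bullet> a = h \<bullet> b"
    by meson
  then show ?thesis
    by (simp only: vector_eq_ldot)
qed

lemma has_derivative_quadratic_form:
  assumes S: "sym_pos_def S" and f: "(f has_derivative f') (at t)"
  shows "((\<lambda>t. f t \<bullet> (S *v f t)) has_derivative (\<lambda>h. 2 * (f' h \<bullet> (S *v f t)))) (at t)"
proof -
  have "f t \<bullet> (S *v f' h) = f' h \<bullet> (S *v f t)" for h
    by (metis S inner_commute sym_pos_def_inner_commute)
  then show ?thesis
    using has_derivative_inner[OF f
        bounded_linear.has_derivative[OF matrix_vector_mul_bounded_linear f, of S]]
    by simp
qed

lemma GDERIV_half_quadratic_form:
  assumes "sym_pos_def S"
  shows "GDERIV (\<lambda>x. x \<bullet> (S *v x) / 2) x :> S *v x"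
  using has_derivative_mult_right[OF has_derivative_quadratic_form[OF assms has_derivative_ident], of "1 / 2"]
  by (simp add: gderiv_def)

text \<open>The normalising factor of the density only adds a constant to the potential; positivity
  of \<open>det S\<close> is what permits the logarithm to be split.\<close>

lemma GDERIV_potential:
  fixes S :: "real^'n^'n"
  assumes "sym_pos_def S"
  shows "GDERIV (potential S) x :> matrix_inv S *v x"
proof -
  have "potential S = (\<lambda>x. x \<bullet> (matrix_inv S *v x) / 2 + ln (sqrt ((2 * pi) ^ CARD('n) * det S)))"
    using sym_pos_def_det_pos[OF assms]
    by (simp add: potential_def gaussian_density_def fun_eq_iff ln_div)
  then show ?thesis
    using GDERIV_add[OF GDERIV_half_quadratic_form[OF sym_pos_def_matrix_inv[OF assms]] GDERIV_const]
    by simp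
qed

lemma GDERIV_kinetic:
  assumes "sym_pos_def M"
  shows "GDERIV (kinetic M) p :> matrix_inv M *v p"
  unfolding kinetic_def[abs_def]
  by (rule GDERIV_half_quadratic_form[OF sym_pos_def_matrix_inv[OF assms]])

section \<open>The linear Hamiltonian system\<close>

text \<open>Hamilton's equations for the energy with quadratic forms \<open>A\<close> in position
  and \<open>B\<close> in momentum. The initial value is kept apart, so that sums, multiples and
  differences of solutions are again covered.\<close>

definition oscillator :: "real^'n^'n \<Rightarrow> real^'n^'n \<Rightarrow> (real \<Rightarrow> (real^'n) \<times> (real^'n)) \<Rightarrow> bool" where
  "oscillator A B z \<longleftrightarrow>
     (\<forall>t. (z has_vector_derivative (B *v snd (z t), - (A *v fst (z t)))) (at t))"

text \<open>Stated as an equivalence so that it can rewrite the description under \<open>THE\<close>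
  in \<open>hamiltonian_flow\<close>.\<close>

lemma hamiltonian_solution_iff_oscillator:
  assumes S: "sym_pos_def S" and M: "sym_pos_def M"
  shows "hamiltonian_solution (hamiltonian S M) a b z \<longleftrightarrow>
    z 0 = (a, b) \<and> oscillator (matrix_inv S) (matrix_inv M) z"
proof -
  have "GDERIV (\<lambda>x. hamiltonian S M x p) x :> matrix_inv S *v x" for x p
    using GDERIV_add[OF GDERIV_potential[OF S] GDERIV_const[where k = "kinetic M p"]]
    by (simp add: hamiltonian_def)
  then have x: "GDERIV (\<lambda>x. hamiltonian S M x p) x :> g \<longleftrightarrow> g = matrix_inv S *v x" for x p g
    by (metis GDERIV_unique)
  have "GDERIV (hamiltonian S M x) p :> matrix_inv M *v p" for x p
    using GDERIV_add[OF GDERIV_const[where k = "potential S x"] GDERIV_kinetic[OF M]]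
    by (simp add: hamiltonian_def[abs_def])
  then have p: "GDERIV (hamiltonian S M x) p :> g \<longleftrightarrow> g = matrix_inv M *v p" for x p g
    by (metis GDERIV_unique)
  show ?thesis
    by (simp add: hamiltonian_solution_def oscillator_def x p)
qed

text \<open>The two contributions to the derivative are opposite multiples of the inner product of
  \<open>B *v snd (z t)\<close> and \<open>A *v fst (z t)\<close>.\<close>

lemma oscillator_energy:
  assumes A: "sym_pos_def A" and B: "sym_pos_def B" and z: "oscillator A B z"
  shows "fst (z t) \<bullet> (A *v fst (z t)) + snd (z t) \<bullet> (B *v snd (z t)) =
    fst (z 0) \<bullet> (A *v fst (z 0)) + snd (z 0) \<bullet> (B *v snd (z 0))"
proof -
  let ?E = "\<lambda>t. fst (z t) \<bullet> (A *v fst (z t)) + snd (z t) \<bullet> (B *v snd (z t))"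
  have "(?E has_real_derivative 0) (at t)" for t
  proof -
    have d: "(z has_derivative (\<lambda>h. h *\<^sub>R (B *v snd (z t), - (A *v fst (z t))))) (at t)"
      using z by (simp add: oscillator_def has_vector_derivative_def)
    have "(?E has_derivative (\<lambda>h. 2 * ((h *\<^sub>R (B *v snd (z t))) \<bullet> (A *v fst (z t))) +
        2 * ((h *\<^sub>R (- (A *v fst (z t)))) \<bullet> (B *v snd (z t))))) (at t)"
      using has_derivative_quadratic_form[OF A has_derivative_fst[OF d]]
        has_derivative_quadratic_form[OF B has_derivative_snd[OF d]]
      by (intro has_derivative_add) simp_all
    then show ?thesis
      unfolding has_field_derivative_def by (rule has_derivative_eq_rhs) (simp add: inner_commute fun_eq_iff)
  qed
  then show ?thesis
    using DERIV_isconst_all[of ?E] by blast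
qed

text \<open>The difference of two solutions is a solution of zero energy, and the energy is positive
  definite.\<close>

lemma oscillator_unique:
  assumes A: "sym_pos_def A" and B: "sym_pos_def B"
    and z: "oscillator A B z" and w: "oscillator A B w" and "z 0 = w 0"
  shows "z = w"
proof
  fix t
  let ?d = "\<lambda>t. z t - w t"
  have "oscillator A B ?d"
    unfolding oscillator_def
  proof
    fix t
    show "(?d has_vector_derivative (B *v snd (?d t), - (A *v fst (?d t)))) (at t)"
      using has_vector_derivative_diff[OF z[unfolded oscillator_def, rule_format, of t]
          w[unfolded oscillator_def, rule_format, of t]]
      by (simp add: matrix_vector_mult_diff_distrib)
  qed
  from oscillator_energy[OF A B this, of t]
  have "fst (?d t) \<bullet> (A *v fst (?d t)) + snd (?d t) \<bullet> (B *v snd (?d t)) = 0"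
    using \<open>z 0 = w 0\<close> by simp
  then have "fst (?d t) = 0" "snd (?d t) = 0"
    using sym_pos_def_nonneg[OF A, of "fst (?d t)"] sym_pos_def_nonneg[OF B, of "snd (?d t)"]
      sym_pos_def_eq_0[OF A, of "fst (?d t)"] sym_pos_def_eq_0[OF B, of "snd (?d t)"]
    by linarith+
  then show "z t = w t"
    by (simp add: prod_eq_iff)
qed

lemma oscillator_exists:
  obtains z where "z 0 = z0" "oscillator A B z"
proof -
  have "linear (\<lambda>u. (B *v snd u, - (A *v fst u)))"
    by (rule linearI)
      (simp_all add: matrix_vector_right_distrib matrix_vector_mult_scaleR)
  then show ?thesis
    using linear_ode_solution_exists[of _ z0] that unfolding oscillator_def by blast
qed

lemma hamiltonian_flow_eqI:
  assumes "sym_pos_def S" "sym_pos_def M"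
    and "z 0 = (a, b)" "oscillator (matrix_inv S) (matrix_inv M) z"
  shows "hamiltonian_flow (hamiltonian S M) a b = z"
  unfolding hamiltonian_flow_def hamiltonian_solution_iff_oscillator[OF assms(1,2)]
proof (rule the_equality)
  show "w = z" if "w 0 = (a, b) \<and> oscillator (matrix_inv S) (matrix_inv M) w" for w
    using that assms
    by (intro oscillator_unique[of "matrix_inv S" "matrix_inv M"]) (simp_all add: sym_pos_def_matrix_inv)
qed (use assms in blast)

lemma hamiltonian_flow_solution:
  fixes S M :: "real^'n^'n"
  assumes "sym_pos_def S" "sym_pos_def M"
  shows "hamiltonian_flow (hamiltonian S M) a b 0 = (a, b)"
    "oscillator (matrix_inv S) (matrix_inv M) (hamiltonian_flow (hamiltonian S M) a b)"
proof -
  obtain z where z: "z 0 = (a, b)" "oscillator (matrix_inv S) (matrix_inv M) z"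
    by (rule oscillator_exists)
  then have "hamiltonian_flow (hamiltonian S M) a b = z"
    by (rule hamiltonian_flow_eqI[OF assms])
  then show "hamiltonian_flow (hamiltonian S M) a b 0 = (a, b)"
    "oscillator (matrix_inv S) (matrix_inv M) (hamiltonian_flow (hamiltonian S M) a b)"
    using z by simp_all
qed

text \<open>Sums and multiples of flows solve the system with the corresponding initial data, so
  uniqueness identifies them with the flow.\<close>

lemma hamiltonian_flow_linear:
  fixes S M :: "real^'n^'n"
  assumes "sym_pos_def S" "sym_pos_def M"
  shows "linear (\<lambda>u. hamiltonian_flow (hamiltonian S M) (fst u) (snd u) T)"
proof -
  let ?F = "hamiltonian_flow (hamiltonian S M)"
  let ?L = "\<lambda>u. (matrix_inv M *v snd u, - (matrix_inv S *v fst u))"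
  have d: "(?F a b has_vector_derivative ?L (?F a b t)) (at t)" for a b t
    using hamiltonian_flow_solution(2)[OF assms] by (simp add: oscillator_def)
  show ?thesis
  proof (rule linearI)
    fix u v :: "(real^'n) \<times> (real^'n)"
    have "?F (fst (u + v)) (snd (u + v)) = (\<lambda>t. ?F (fst u) (snd u) t + ?F (fst v) (snd v) t)"
    proof (rule hamiltonian_flow_eqI[OF assms])
      show "?F (fst u) (snd u) 0 + ?F (fst v) (snd v) 0 = (fst (u + v), snd (u + v))"
        by (simp only: hamiltonian_flow_solution(1)[OF assms] prod.collapse)
      show "oscillator (matrix_inv S) (matrix_inv M) (\<lambda>t. ?F (fst u) (snd u) t + ?F (fst v) (snd v) t)"
        using has_vector_derivative_add[OF d d]
        by (simp add: oscillator_def matrix_vector_right_distrib)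
    qed
    then show "?F (fst (u + v)) (snd (u + v)) T = ?F (fst u) (snd u) T + ?F (fst v) (snd v) T"
      by simp
  next
    fix r :: real and u :: "(real^'n) \<times> (real^'n)"
    have "((\<lambda>t. r *\<^sub>R ?F (fst u) (snd u) t) has_vector_derivative r *\<^sub>R ?L (?F (fst u) (snd u) t)) (at t)" for t
      by (rule bounded_linear.has_vector_derivative[OF bounded_linear_scaleR_right d])
    then have r: "oscillator (matrix_inv S) (matrix_inv M) (\<lambda>t. r *\<^sub>R ?F (fst u) (snd u) t)"
      by (simp add: oscillator_def matrix_vector_mult_scaleR)
    have "?F (fst (r *\<^sub>R u)) (snd (r *\<^sub>R u)) = (\<lambda>t. r *\<^sub>R ?F (fst u) (snd u) t)"
    proof (rule hamiltonian_flow_eqI[OF assms _ r])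
      show "r *\<^sub>R ?F (fst u) (snd u) 0 = (fst (r *\<^sub>R u), snd (r *\<^sub>R u))"
        by (simp only: hamiltonian_flow_solution(1)[OF assms] prod.collapse)
    qed
    then show "?F (fst (r *\<^sub>R u)) (snd (r *\<^sub>R u)) T = r *\<^sub>R ?F (fst u) (snd u) T"
      by simp
  qed
qed

text \<open>For the second property, start at position 0 with momentum \<open>b\<close>: the energy
  is then purely kinetic, and the nonnegative kinetic part at time \<open>T\<close> is
  dropped.\<close>

lemma position_at_decomposition:
  fixes S M :: "real^'n^'n"
  assumes S: "sym_pos_def S" and M: "sym_pos_def M"
  obtains C D where
    "\<And>a b. position_at S M T a b = D *v a + C *v b"
    "\<And>b. (C *v b) \<bullet> (matrix_inv S *v (C *v b)) \<le> b \<bullet> (matrix_inv M *v b)"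
proof -
  let ?F = "hamiltonian_flow (hamiltonian S M)"
  note inv = sym_pos_def_matrix_inv[OF S] sym_pos_def_matrix_inv[OF M]
  define P where "P = fst \<circ> (\<lambda>u. ?F (fst u) (snd u) T)"
  have P: "linear P"
    unfolding P_def by (rule linear_compose[OF hamiltonian_flow_linear[OF assms] linear_fst])
  have position: "position_at S M T a b = P (a, b)" for a b
    by (simp add: P_def position_at_def)
  have l: "linear (\<lambda>a. (a, 0 :: real^'n))" "linear (\<lambda>b. (0 :: real^'n, b))"
    by (auto intro!: linearI)
  define D where "D = matrix (P \<circ> (\<lambda>a. (a, 0)))"
  define C where "C = matrix (P \<circ> (\<lambda>b. (0, b)))"
  have D: "D *v a = P (a, 0)" for a
    unfolding D_def using fun_cong[OF matrix_vector_mul(2)[OF linear_compose[OF l(1) P]]] by simp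
  have C: "C *v b = P (0, b)" for b
    unfolding C_def using fun_cong[OF matrix_vector_mul(2)[OF linear_compose[OF l(2) P]]] by simp
  show thesis
  proof (rule that)
    show "position_at S M T a b = D *v a + C *v b" for a b
      using linear_add[OF P, of "(a, 0)" "(0, b)"] by (simp add: C D position)
    show "(C *v b) \<bullet> (matrix_inv S *v (C *v b)) \<le> b \<bullet> (matrix_inv M *v b)" for b
    proof -
      have "C *v b = fst (?F 0 b T)"
        unfolding C by (simp add: P_def)
      then show ?thesis
        using oscillator_energy[OF inv hamiltonian_flow_solution(2)[OF assms, of 0 b], of T]
          sym_pos_def_nonneg[OF inv(2), of "snd (?F 0 b T)"]
        by (simp add: hamiltonian_flow_solution(1)[OF assms])
    qed
  qed
qed

text \<open>With this mass matrix the equations give \<open>x'' = - x\<close>, so every direction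
  oscillates with frequency 1 and the flow has a closed form.\<close>

lemma position_at_matrix_inv:
  assumes S: "sym_pos_def S"
  shows "position_at S (matrix_inv S) T a b = cos T *\<^sub>R a + sin T *\<^sub>R (S *v b)"
proof -
  define z where
    "z t = (cos t *\<^sub>R a + sin t *\<^sub>R (S *v b), cos t *\<^sub>R b - sin t *\<^sub>R (matrix_inv S *v a))" for t
  have "oscillator (matrix_inv S) S z"
    unfolding oscillator_def
  proof
    fix t
    have "(z has_vector_derivative
        (- sin t *\<^sub>R a + cos t *\<^sub>R (S *v b), - sin t *\<^sub>R b - cos t *\<^sub>R (matrix_inv S *v a))) (at t)"
      unfolding z_def[abs_def] by (auto intro!: derivative_eq_intros has_vector_derivative_Pair)
    then show "(z has_vector_derivative (S *v snd (z t), - (matrix_inv S *v fst (z t)))) (at t)"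
      by (rule has_vector_derivative_eq_rhs)
        (simp add: z_def matrix_vector_right_distrib matrix_vector_mult_diff_distrib
          matrix_vector_mult_scaleR S)
  qed
  then have "hamiltonian_flow (hamiltonian S (matrix_inv S)) a b = z"
    using S by (intro hamiltonian_flow_eqI)
      (simp_all add: z_def sym_pos_def_matrix_inv matrix_inv_matrix_inv_sym_pos_def)
  then show ?thesis
    by (simp add: position_at_def z_def)
qed

section \<open>Gaussian moments\<close>

text \<open>Removes an error linear in \<open>s\<close> by passing to the limit from the right. The
  condition with \<open>L\<close> admits estimates that hold only for small
  \<open>s\<close>.\<close>

lemma le_of_le_add_small:
  fixes a b K L :: real
  assumes "\<And>s. 0 < s \<Longrightarrow> s \<le> 1 \<Longrightarrow> s * L \<le> 1 \<Longrightarrow> a \<le> b + s * K"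
  shows "a \<le> b"
proof (rule tendsto_lowerbound)
  have "((\<lambda>s. b + s * K) \<longlongrightarrow> b + 0 * K) (at_right 0)"
    by (intro tendsto_intros)
  then show "((\<lambda>s. b + s * K) \<longlongrightarrow> b) (at_right 0)"
    by simp
  \<comment> \<open>This threshold enforces both \<open>s \<le> 1\<close> and
    \<open>s * L \<le> 1\<close>.\<close>
  have "a \<le> b + s * K" if "0 < s" "s < 1 / (\<bar>L\<bar> + 1)" for s
  proof (rule assms)
    have "s * (\<bar>L\<bar> + 1) \<le> 1"
      using that by (simp add: pos_less_divide_eq)
    moreover have "s * (\<bar>L\<bar> + 1) = s * \<bar>L\<bar> + s" "0 \<le> s * \<bar>L\<bar>" "s * L \<le> s * \<bar>L\<bar>"
      using that by (simp_all add: mult_left_mono distrib_left)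
    ultimately show "s \<le> 1" "s * L \<le> 1"
      using \<open>0 < s\<close> by linarith+
  qed (use that in simp)
  then show "eventually (\<lambda>s. a \<le> b + s * K) (at_right 0)"
    by (intro eventually_at_rightI[of 0 "1 / (\<bar>L\<bar> + 1)"]) auto
qed simp

lemma exp_Maclaurin4:
  fixes y :: real
  obtains t where "\<bar>t\<bar> \<le> \<bar>y\<bar>" "exp y = 1 + y + y\<^sup>2 / 2 + y ^ 3 / 6 + exp t * y ^ 4 / 24"
proof -
  obtain t where "\<bar>t\<bar> \<le> \<bar>y\<bar>" "exp y = (\<Sum>m<4. y ^ m / fact m) + exp t / fact 4 * y ^ 4"
    using Maclaurin_exp_le by blast
  then show thesis
    by (intro that[of t]) (simp_all add: eval_nat_numeral)
qed

text \<open>The odd terms of the two expansions cancel and the remainders are nonnegative.\<close>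

lemma two_plus_square_le_cosh:
  fixes y :: real
  shows "2 + y\<^sup>2 \<le> exp y + exp (- y)"
proof -
  obtain t where "exp y = 1 + y + y\<^sup>2 / 2 + y ^ 3 / 6 + exp t * y ^ 4 / 24"
    by (rule exp_Maclaurin4)
  moreover obtain t' where "exp (- y) = 1 + (- y) + (- y)\<^sup>2 / 2 + (- y) ^ 3 / 6 + exp t' * (- y) ^ 4 / 24"
    by (rule exp_Maclaurin4)
  moreover have "0 \<le> exp t * y ^ 4 / 24" "0 \<le> exp t' * y ^ 4 / 24"
    by simp_all
  ultimately show ?thesis
    by (simp add: power3_eq_cube)
qed

lemma cosh_le:
  fixes y :: real
  shows "exp y + exp (- y) \<le> 2 + y\<^sup>2 + y ^ 4 * exp \<bar>y\<bar> / 12"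
proof -
  obtain t where t: "\<bar>t\<bar> \<le> \<bar>y\<bar>" "exp y = 1 + y + y\<^sup>2 / 2 + y ^ 3 / 6 + exp t * y ^ 4 / 24"
    by (rule exp_Maclaurin4)
  obtain t' where t': "\<bar>t'\<bar> \<le> \<bar>- y\<bar>"
      "exp (- y) = 1 + (- y) + (- y)\<^sup>2 / 2 + (- y) ^ 3 / 6 + exp t' * (- y) ^ 4 / 24"
    by (rule exp_Maclaurin4)
  have "exp t * y ^ 4 \<le> exp \<bar>y\<bar> * y ^ 4" "exp t' * y ^ 4 \<le> exp \<bar>y\<bar> * y ^ 4"
    using t(1) t'(1) by (intro mult_right_mono; simp)+
  then show ?thesis
    using t(2) t'(2) by (simp add: power3_eq_cube mult_ac)
qed

text \<open>In an expansion to order 6 the quartic terms add up to \<open>y ^ 4 / 12\<close>; the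
  odd terms cancel and everything else is nonnegative.\<close>

lemma power4_le_cosh:
  fixes y :: real
  shows "y ^ 4 \<le> 12 * (exp y + exp (- y))"
proof -
  have *: "\<exists>r\<ge>0. exp z = 1 + z + z\<^sup>2 / 2 + z ^ 3 / 6 + z ^ 4 / 24 + z ^ 5 / 120 + r" for z :: real
  proof -
    obtain t where "exp z = (\<Sum>m<6. z ^ m / fact m) + exp t / fact 6 * z ^ 6"
      using Maclaurin_exp_le by blast
    moreover have "0 \<le> exp t / fact 6 * z ^ 6"
      by simp
    ultimately show ?thesis
      by (intro exI[of _ "exp t / fact 6 * z ^ 6"]) (simp add: eval_nat_numeral)
  qed
  obtain r r' where "0 \<le> r" "0 \<le> r'"
    "exp y = 1 + y + y\<^sup>2 / 2 + y ^ 3 / 6 + y ^ 4 / 24 + y ^ 5 / 120 + r"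
    "exp (- y) = 1 + (- y) + (- y)\<^sup>2 / 2 + (- y) ^ 3 / 6 + (- y) ^ 4 / 24 + (- y) ^ 5 / 120 + r'"
    using * by blast
  then show ?thesis
    using zero_le_power2[of y] by (simp add: power_minus_odd)
qed

text \<open>Separates \<open>s\<close> from the error term: what multiplies \<open>s ^ 4\<close>
  depends on \<open>y\<close> alone and is a combination of exponentials, hence integrable once
  \<open>y\<close> is replaced by the random variable.\<close>

lemma cosh_scaled_le:
  fixes s y :: real
  assumes "0 < s" "s \<le> 1"
  shows "exp (s * y) + exp (- s * y) \<le> 2 + s\<^sup>2 * y\<^sup>2 + s ^ 4 * (exp y + exp (- y))\<^sup>2"
proof -
  have "exp \<bar>s * y\<bar> \<le> exp y + exp (- y)"
  proof -
    have "\<bar>s * y\<bar> \<le> \<bar>y\<bar>"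
      using assms by (simp add: abs_mult mult_left_le_one_le)
    then have "exp \<bar>s * y\<bar> \<le> exp \<bar>y\<bar>"
      by simp
    also have "\<dots> \<le> exp y + exp (- y)"
      by (cases "0 \<le> y") (simp_all add: add_increasing add_increasing2)
    finally show ?thesis .
  qed
  then have "y ^ 4 * exp \<bar>s * y\<bar> \<le> 12 * (exp y + exp (- y)) * (exp y + exp (- y))"
    by (intro mult_mono power4_le_cosh) (auto simp: add_nonneg_nonneg)
  then have "s ^ 4 * (y ^ 4 * exp \<bar>s * y\<bar>) \<le> s ^ 4 * (12 * (exp y + exp (- y)) * (exp y + exp (- y)))"
    by (rule mult_left_mono) simp
  also have "\<dots> = 12 * (s ^ 4 * (exp y + exp (- y))\<^sup>2)"
    by (simp only: power2_eq_square mult_ac)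
  finally show ?thesis
    using cosh_le[of "s * y"] by (simp add: power_mult_distrib mult.assoc)
qed

text \<open>The moments are squeezed by Taylor bounds for \<open>exp (s W)\<close> and \<open>cosh (s W)\<close> as
  \<open>s\<close> tends to 0, which replaces differentiation under the integral.\<close>

lemma (in prob_space) moments_of_gaussian_mgf:
  fixes W :: "'a \<Rightarrow> real"
  assumes [measurable]: "W \<in> borel_measurable M"
    and int: "\<And>s. integrable M (\<lambda>w. exp (s * W w))"
    and mgf: "\<And>s. expectation (\<lambda>w. exp (s * W w)) = exp (s\<^sup>2 * v / 2)"
    and v: "0 \<le> v"
  shows "integrable M W" "expectation W = 0"
    "integrable M (\<lambda>w. (W w)\<^sup>2)" "expectation (\<lambda>w. (W w)\<^sup>2) = v"
proof -
  let ?c = "\<lambda>w. exp (W w) + exp (- W w)"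
  have int_cosh: "integrable M (\<lambda>w. exp (s * W w) + exp (- s * W w))" for s
    using int[of s] int[of "- s"] by simp
  show int2: "integrable M (\<lambda>w. (W w)\<^sup>2)"
  proof (rule Bochner_Integration.integrable_bound)
    show "integrable M ?c"
      using int_cosh[of 1] by simp
    have "(W w)\<^sup>2 \<le> ?c w" for w
      using two_plus_square_le_cosh[of "W w"] by linarith
    then show "AE w in M. norm ((W w)\<^sup>2) \<le> norm (?c w)"
      by (intro AE_I2) (metis abs_ge_self abs_power2 order_trans real_norm_def)
  qed simp
  show int1: "integrable M W"
    using int2 by (rule square_integrable_imp_integrable[rotated]) simp
  \<comment> \<open>Multiplying \<open>s \<le> 1\<close> and \<open>s * v \<le> 1\<close> brings the
    exponent into the range where \<open>exp x \<le> 1 + x + x\<^sup>2\<close>.\<close>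
  have exp_le: "exp (s\<^sup>2 * v / 2) \<le> 1 + s\<^sup>2 * v / 2 + (s\<^sup>2 * v / 2)\<^sup>2" "s\<^sup>2 * v / 2 \<le> 1"
    if "0 < s" "s \<le> 1" "s * v \<le> 1" for s
  proof -
    have "s\<^sup>2 * v \<le> 1"
      using that v mult_mono[of s 1 "s * v" 1] by (simp add: power2_eq_square mult_ac)
    then show *: "s\<^sup>2 * v / 2 \<le> 1" by simp
    show "exp (s\<^sup>2 * v / 2) \<le> 1 + s\<^sup>2 * v / 2 + (s\<^sup>2 * v / 2)\<^sup>2"
      using v * by (intro exp_bound) simp_all
  qed
  \<comment> \<open>Integrating \<open>1 + y \<le> exp y\<close> at \<open>y = s * r * W w\<close>
    and dividing by \<open>s\<close>; both signs of \<open>r\<close> together give mean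
    zero.\<close>
  have "r * expectation W \<le> 0" if "\<bar>r\<bar> = 1" for r
  proof (rule le_of_le_add_small)
    fix s :: real assume s: "0 < s" "s \<le> 1" "s * v \<le> 1"
    have "1 + s * r * expectation W = expectation (\<lambda>w. 1 + s * r * W w)"
      using int1 by (simp add: prob_space)
    also have "\<dots> \<le> expectation (\<lambda>w. exp (s * r * W w))"
      using int1 int by (intro integral_mono) auto
    also have "\<dots> = exp (s\<^sup>2 * v / 2)"
      using that mgf[of "s * r"] by (simp add: power_mult_distrib power2_eq_1_iff abs_if split: if_splits)
    also have "\<dots> \<le> 1 + s\<^sup>2 * v / 2 + s\<^sup>2 * v / 2"
    proof -
      have "(s\<^sup>2 * v / 2)\<^sup>2 \<le> s\<^sup>2 * v / 2"
        unfolding power2_eq_square[of "s\<^sup>2 * v / 2"] using exp_le(2)[OF s] v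
        by (intro mult_left_le) simp_all
      then show ?thesis using exp_le(1)[OF s] by linarith
    qed
    finally have "s * (r * expectation W) \<le> s * (s * v)"
      by (simp add: power2_eq_square algebra_simps)
    then show "r * expectation W \<le> 0 + s * v"
      using s(1) by simp
  qed
  from this[of 1] this[of "- 1"] show "expectation W = 0"
    by simp
  have "expectation (\<lambda>w. (W w)\<^sup>2) \<le> v"
  proof (rule le_of_le_add_small)
    fix s :: real assume s: "0 < s" "s \<le> 1" "s * v \<le> 1"
    have "2 + s\<^sup>2 * expectation (\<lambda>w. (W w)\<^sup>2) = expectation (\<lambda>w. 2 + s\<^sup>2 * (W w)\<^sup>2)"
      using int2 by (simp add: prob_space)
    also have "\<dots> \<le> expectation (\<lambda>w. exp (s * W w) + exp (- s * W w))"
    proof (rule integral_mono[OF _ int_cosh])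
      show "2 + s\<^sup>2 * (W w)\<^sup>2 \<le> exp (s * W w) + exp (- s * W w)" for w
        using two_plus_square_le_cosh[of "s * W w"] by (simp add: power_mult_distrib)
    qed (use int2 in simp)
    also have "\<dots> = 2 * exp (s\<^sup>2 * v / 2)"
      using int[of s] int[of "- s"] mgf[of s] mgf[of "- s"] by simp
    also have "\<dots> \<le> 2 * (1 + s\<^sup>2 * v / 2 + (s\<^sup>2 * v / 2)\<^sup>2)"
      using exp_le(1)[OF s] by simp
    also have "\<dots> = 2 + s\<^sup>2 * (v + s\<^sup>2 * (v\<^sup>2 / 2))"
      by (simp add: power2_eq_square field_simps)
    finally have "expectation (\<lambda>w. (W w)\<^sup>2) \<le> v + s\<^sup>2 * (v\<^sup>2 / 2)"
      using s(1) by simp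
    \<comment> \<open>The quadratic error is weakened to a linear one, the form wanted by the limit
      lemma.\<close>
    moreover have "s\<^sup>2 * (v\<^sup>2 / 2) \<le> s * (v\<^sup>2 / 2)"
      using s by (intro mult_right_mono) (simp_all add: power2_eq_square mult_left_le)
    ultimately show "expectation (\<lambda>w. (W w)\<^sup>2) \<le> v + s * (v\<^sup>2 / 2)"
      by linarith
  qed
  moreover have "v \<le> expectation (\<lambda>w. (W w)\<^sup>2)"
  proof (rule le_of_le_add_small)
    fix s :: real assume s: "0 < s" "s \<le> 1" "s * v \<le> 1"
    let ?K = "expectation (\<lambda>w. (?c w)\<^sup>2)"
    \<comment> \<open>The square expands into exponentials of \<open>2 * W w\<close> and
      \<open>- 2 * W w\<close> and a constant.\<close>
    have int4: "integrable M (\<lambda>w. (?c w)\<^sup>2)"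
    proof -
      have "(\<lambda>w. (?c w)\<^sup>2) = (\<lambda>w. exp (2 * W w) + 2 + exp (- 2 * W w))"
        by (simp add: fun_eq_iff power2_sum exp_double exp_minus_inverse mult.assoc
            exp_double[of "- W _", simplified])
      then show ?thesis
        using int[of 2] int[of "- 2"] by simp
    qed
    have "2 + s\<^sup>2 * v \<le> 2 * exp (s\<^sup>2 * v / 2)"
      using exp_ge_add_one_self[of "s\<^sup>2 * v / 2"] by linarith
    also have "\<dots> = expectation (\<lambda>w. exp (s * W w) + exp (- s * W w))"
      using int[of s] int[of "- s"] mgf[of s] mgf[of "- s"] by simp
    also have "\<dots> \<le> expectation (\<lambda>w. 2 + s\<^sup>2 * (W w)\<^sup>2 + s ^ 4 * (?c w)\<^sup>2)"
      using int2 int4 cosh_scaled_le[OF s(1,2)] by (intro integral_mono[OF int_cosh]) auto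
    also have "\<dots> = 2 + s\<^sup>2 * expectation (\<lambda>w. (W w)\<^sup>2) + s ^ 4 * ?K"
      using int2 int4 by (simp add: prob_space)
    finally have "s\<^sup>2 * v \<le> s\<^sup>2 * (expectation (\<lambda>w. (W w)\<^sup>2) + s\<^sup>2 * ?K)"
      by (simp add: power2_eq_square power4_eq_xxxx algebra_simps)
    then have "v \<le> expectation (\<lambda>w. (W w)\<^sup>2) + s\<^sup>2 * ?K"
      using s(1) by simp
    moreover have "s\<^sup>2 * ?K \<le> s * ?K"
      using s by (intro mult_right_mono integral_nonneg_AE)
        (simp_all add: power2_eq_square mult_left_le)
    ultimately show "v \<le> expectation (\<lambda>w. (W w)\<^sup>2) + s * ?K"
      by linarith
  qed
  ultimately show "expectation (\<lambda>w. (W w)\<^sup>2) = v"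
    by (rule antisym)
qed

section \<open>Exponential and second moments of Gaussian vectors\<close>

lemma continuous_gaussian_density: "continuous_on UNIV (gaussian_density S)"
  unfolding gaussian_density_def[abs_def] divide_inverse
  by (intro continuous_intros linear_continuous_on matrix_vector_mul_bounded_linear)

text \<open>Completing the square: the exponential factor shifts the mean to \<open>S *v u\<close>.
  The shift is written as a left addition to match the translation of Lebesgue measure.\<close>

lemma gaussian_density_times_exp:
  assumes S: "sym_pos_def S"
  shows "gaussian_density S x * exp (u \<bullet> x) =
    exp (u \<bullet> (S *v u) / 2) * gaussian_density S (- (S *v u) + x)"
proof -
  let ?I = "matrix_inv S"
  have "(S *v u) \<bullet> (?I *v x) = u \<bullet> x" "x \<bullet> u = u \<bullet> x" "(S *v u) \<bullet> u = u \<bullet> (S *v u)"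
    using S sym_pos_def_inner_commute[OF S, of u "?I *v x"] by (simp_all add: inner_commute)
  then have "(x - S *v u) \<bullet> (?I *v (x - S *v u)) = x \<bullet> (?I *v x) - 2 * (u \<bullet> x) + u \<bullet> (S *v u)"
    using S by (simp add: matrix_vector_mult_diff_distrib inner_diff_left inner_diff_right)
  then have "- (x \<bullet> (?I *v x)) / 2 + u \<bullet> x =
      u \<bullet> (S *v u) / 2 + - ((- (S *v u) + x) \<bullet> (?I *v (- (S *v u) + x))) / 2"
    by (simp add: field_simps)
  then show ?thesis
    unfolding gaussian_density_def by (simp only: times_divide_eq_left times_divide_eq_right exp_add[symmetric])
qed

lemma gaussian_exp_moment:
  fixes X :: "'w \<Rightarrow> real^'n"
  assumes "prob_space P" and X: "gaussian_rv P S X" and S: "sym_pos_def S"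
  shows "integrable P (\<lambda>w. exp (u \<bullet> X w))"
    "(\<integral>w. exp (u \<bullet> X w) \<partial>P) = exp (u \<bullet> (S *v u) / 2)"
proof -
  interpret prob_space P by fact
  let ?f = "\<lambda>x. ennreal (gaussian_density S x)" and ?a = "exp (u \<bullet> (S *v u) / 2)"
  have d: "distributed P lborel X ?f"
    using X by (simp add: gaussian_rv_def)
  have [measurable]: "X \<in> borel_measurable P"
    using distributed_measurable[OF d] by simp
  have [measurable]: "gaussian_density S \<in> borel_measurable borel"
    by (rule borel_measurable_continuous_onI[OF continuous_gaussian_density])
  have "(\<integral>\<^sup>+ w. ennreal (exp (u \<bullet> X w)) \<partial>P) = (\<integral>\<^sup>+ x. ?f x * ennreal (exp (u \<bullet> x)) \<partial>lborel)"
    by (rule distributed_nn_integral[OF d, symmetric]) simp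
  also have "\<dots> = (\<integral>\<^sup>+ x. ennreal ?a * ?f (- (S *v u) + x) \<partial>lborel)"
    using gaussian_density_times_exp[OF S]
    by (simp add: ennreal_mult''[symmetric] ennreal_mult'[symmetric])
  also have "\<dots> = ennreal ?a * (\<integral>\<^sup>+ x. ?f (- (S *v u) + x) \<partial>lborel)"
    by (rule nn_integral_cmult) simp
  also have "(\<integral>\<^sup>+ x. ?f (- (S *v u) + x) \<partial>lborel) =
      (\<integral>\<^sup>+ x. ?f x \<partial>distr lborel borel ((+) (- (S *v u))))"
    by (subst nn_integral_distr) simp_all
  also have "\<dots> = (\<integral>\<^sup>+ x. ?f x * 1 \<partial>lborel)"
    by (simp add: lborel_distr_plus)
  \<comment> \<open>The density has mass 1 because it is the density of \<open>X\<close> on a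
    probability space; no Gaussian integral is computed.\<close>
  also have "\<dots> = 1"
    using distributed_nn_integral[OF d, of "\<lambda>_. 1"] emeasure_space_1 by simp
  finally have nn: "(\<integral>\<^sup>+ w. ennreal (exp (u \<bullet> X w)) \<partial>P) = ennreal ?a"
    by simp
  then show "integrable P (\<lambda>w. exp (u \<bullet> X w))"
    by (intro integrableI_nonneg) simp_all
  show "(\<integral>w. exp (u \<bullet> X w) \<partial>P) = ?a"
    using nn by (intro integral_eq_nn_integral[THEN trans]) simp_all
qed

text \<open>Along the line through \<open>u\<close> the exponential moments are those required by
  \<open>moments_of_gaussian_mgf\<close>, with variance \<open>u \<bullet> (S *v u)\<close>. Mixed
  moments follow by polarization.\<close>

lemma gaussian_moments:
  fixes X :: "'w \<Rightarrow> real^'n"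
  assumes P: "prob_space P" and X: "gaussian_rv P S X" and S: "sym_pos_def S"
  shows "integrable P (\<lambda>w. u \<bullet> X w)" "(\<integral>w. u \<bullet> X w \<partial>P) = 0"
    "integrable P (\<lambda>w. (u \<bullet> X w) * (v \<bullet> X w))"
    "(\<integral>w. (u \<bullet> X w) * (v \<bullet> X w) \<partial>P) = u \<bullet> (S *v v)"
proof -
  interpret prob_space P by fact
  have [measurable]: "X \<in> borel_measurable P"
    using X distributed_measurable[of P lborel X] by (simp add: gaussian_rv_def)
  have exp_moment: "integrable P (\<lambda>w. exp (s * (u \<bullet> X w)))"
    "expectation (\<lambda>w. exp (s * (u \<bullet> X w))) = exp (s\<^sup>2 * (u \<bullet> (S *v u)) / 2)" for s u
    using gaussian_exp_moment[OF P X S, of "s *\<^sub>R u"]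
    by (simp_all add: matrix_vector_mult_scaleR power2_eq_square mult.assoc)
  note moments = moments_of_gaussian_mgf[OF _ exp_moment sym_pos_def_nonneg[OF S]]
  show "integrable P (\<lambda>w. u \<bullet> X w)" "(\<integral>w. u \<bullet> X w \<partial>P) = 0"
    by (rule moments; simp)+
  have sq: "integrable P (\<lambda>w. (u \<bullet> X w)\<^sup>2)" "expectation (\<lambda>w. (u \<bullet> X w)\<^sup>2) = u \<bullet> (S *v u)" for u
    by (rule moments; simp)+
  have polarize: "(u \<bullet> X w) * (v \<bullet> X w) =
      (((u + v) \<bullet> X w)\<^sup>2 - (u \<bullet> X w)\<^sup>2 - (v \<bullet> X w)\<^sup>2) / 2" for w
    by (simp add: inner_add_left power2_sum)
  show "integrable P (\<lambda>w. (u \<bullet> X w) * (v \<bullet> X w))"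
    unfolding polarize using sq(1)[of "u + v"] sq(1)[of u] sq(1)[of v] by simp
  have "v \<bullet> (S *v u) = u \<bullet> (S *v v)"
    by (metis S inner_commute sym_pos_def_inner_commute)
  then show "(\<integral>w. (u \<bullet> X w) * (v \<bullet> X w) \<partial>P) = u \<bullet> (S *v v)"
    unfolding polarize using sq(1)[of "u + v"] sq(1)[of u] sq(1)[of v]
    by (simp add: sq(2) del: inner_add_left)
      (simp add: matrix_vector_right_distrib inner_add_left inner_add_right)
qed

section \<open>Conditional covariance\<close>

lemma (in prob_space) sigma_finite_subalgebra_vimage_algebra:
  assumes "X \<in> borel_measurable M"
  shows "sigma_finite_subalgebra M (vimage_algebra (space M) X borel)"
proof -
  have "subalgebra M (vimage_algebra (space M) X borel)"
    using assms by (auto simp: subalgebra_def sets_vimage_algebra2 intro!: measurable_sets)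
  then show ?thesis
    by (intro finite_measure_subalgebra_is_sigma_finite finite_measure_subalgebra.intro
        finite_measure_subalgebra_axioms.intro) unfold_locales
qed

text \<open>A set of the generated sigma-algebra is a preimage under \<open>X\<close>, so its
  indicator is a function of \<open>X\<close> and the integral of \<open>g (Y w)\<close> over it
  factors.\<close>

lemma (in prob_space) real_cond_exp_indep:
  fixes X Y :: "'a \<Rightarrow> 'b::topological_space" and g :: "'b \<Rightarrow> real"
  assumes indep: "indep_var borel X borel Y" and [measurable]: "g \<in> borel_measurable borel"
    and int_g: "integrable M (\<lambda>w. g (Y w))"
  shows "AE w in M. real_cond_exp M (vimage_algebra (space M) X borel) (\<lambda>w. g (Y w)) w =
    expectation (\<lambda>w. g (Y w))"
proof -
  let ?F = "vimage_algebra (space M) X borel" and ?m = "expectation (\<lambda>w. g (Y w))"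
  have [measurable]: "X \<in> borel_measurable M"
    using indep by (rule indep_var_rv1)
  interpret sigma_finite_subalgebra M ?F
    by (rule sigma_finite_subalgebra_vimage_algebra) simp
  show ?thesis
  proof (rule real_cond_exp_charact[OF _ int_g])
    fix A assume "A \<in> sets ?F"
    then obtain B where B: "B \<in> sets borel" "A = X -` B \<inter> space M"
      by (auto simp: sets_vimage_algebra2)
    let ?I = "\<lambda>x. indicator B x :: real"
    have [measurable]: "?I \<in> borel_measurable borel"
      using B by simp
    have ind: "indep_var borel (?I \<circ> X) borel (g \<circ> Y)"
      by (rule indep_var_compose[OF indep]) simp_all
    have [measurable]: "?I \<circ> X \<in> borel_measurable M"
      by (rule measurable_comp[of X M borel]) simp_all
    have int: "integrable M (?I \<circ> X)"
      by (rule integrable_const_bound[where B = 1]) (auto split: split_indicator)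
    have eq: "indicator A w * c = ?I (X w) * c" if "w \<in> space M" for w and c :: real
      using that B by (simp add: indicator_def)
    have "(\<integral>w\<in>A. g (Y w) \<partial>M) = expectation (\<lambda>w. (?I \<circ> X) w * (g \<circ> Y) w)"
      unfolding set_lebesgue_integral_def by (rule Bochner_Integration.integral_cong) (simp_all add: eq)
    also have "\<dots> = expectation (?I \<circ> X) * ?m"
      using indep_var_lebesgue_integral[OF ind int] int_g by (simp add: o_def)
    also have "\<dots> = (\<integral>w\<in>A. ?m \<partial>M)"
    proof -
      have "(\<integral>w\<in>A. ?m \<partial>M) = expectation (\<lambda>w. (?I \<circ> X) w * ?m)"
        unfolding set_lebesgue_integral_def by (rule Bochner_Integration.integral_cong) (simp_all add: eq)
      then show ?thesis
        using int by (simp add: o_def)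
    qed
    finally show "(\<integral>w\<in>A. g (Y w) \<partial>M) = (\<integral>w\<in>A. ?m \<partial>M)" .
  qed simp_all
qed

text \<open>Given \<open>X\<close>, the summand \<open>f (X w)\<close> is known and
  \<open>g (Y w)\<close> is centered, so the deviation from the conditional mean is
  \<open>g (Y w)\<close>, whose products are independent of \<open>X\<close>.\<close>

lemma (in prob_space) cond_cov_given_indep_add:
  fixes X Y :: "'a \<Rightarrow> real^'n" and f g :: "real^'n \<Rightarrow> real^'n"
  assumes indep: "indep_var borel X borel Y"
    and [measurable]: "f \<in> borel_measurable borel" "g \<in> borel_measurable borel"
    and f: "\<And>i. integrable M (\<lambda>w. f (X w) $ i)"
    and g: "\<And>i. integrable M (\<lambda>w. g (Y w) $ i)" "\<And>i. expectation (\<lambda>w. g (Y w) $ i) = 0"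
    and gg: "\<And>i j. integrable M (\<lambda>w. g (Y w) $ i * g (Y w) $ j)"
  shows "AE w in M. cond_cov_given M (\<lambda>w. f (X w) + g (Y w)) X w =
    (\<chi> i j. expectation (\<lambda>w. g (Y w) $ i * g (Y w) $ j))"
proof -
  let ?F = "vimage_algebra (space M) X borel" and ?Z = "\<lambda>w. f (X w) + g (Y w)"
  let ?ce = "real_cond_exp M ?F"
  have [measurable]: "X \<in> borel_measurable M" "Y \<in> borel_measurable M"
    using indep by (rule indep_var_rv1, rule indep_var_rv2)
  interpret sigma_finite_subalgebra M ?F
    by (rule sigma_finite_subalgebra_vimage_algebra) simp
  have [measurable]: "(\<lambda>x. x $ i) \<in> borel_measurable borel" for i :: 'n
    by (intro borel_measurable_continuous_onI continuous_intros)
  have X_F [measurable]: "X \<in> borel_measurable ?F"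
    by (rule measurable_vimage_algebra1) simp
  have mean: "AE w in M. ?ce (\<lambda>w. ?Z w $ i) w = f (X w) $ i" for i
  proof -
    have "AE w in M. ?ce (\<lambda>w. f (X w) $ i + g (Y w) $ i) w =
        ?ce (\<lambda>w. f (X w) $ i) w + ?ce (\<lambda>w. g (Y w) $ i) w"
      by (rule real_cond_exp_add[OF f g(1)])
    moreover have "AE w in M. ?ce (\<lambda>w. f (X w) $ i) w = f (X w) $ i"
      by (intro real_cond_exp_F_meas[OF f] measurable_compose[OF X_F]) measurable
    moreover have "AE w in M. ?ce (\<lambda>w. g (Y w) $ i) w = 0"
      using real_cond_exp_indep[OF indep, of "\<lambda>y. g y $ i"] g by simp
    ultimately show ?thesis
      by eventually_elim simp
  qed
  have "AE w in M. ?ce (\<lambda>v. (?Z v $ i - ?ce (\<lambda>u. ?Z u $ i) v) * (?Z v $ j - ?ce (\<lambda>u. ?Z u $ j) v)) w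
      = expectation (\<lambda>w. g (Y w) $ i * g (Y w) $ j)" for i j
  proof -
    have [measurable]: "?ce h \<in> borel_measurable M" for h
      by (rule measurable_from_subalg[OF subalg borel_measurable_cond_exp])
    have "AE w in M. (?Z w $ i - ?ce (\<lambda>u. ?Z u $ i) w) * (?Z w $ j - ?ce (\<lambda>u. ?Z u $ j) w)
        = g (Y w) $ i * g (Y w) $ j"
      using mean[of i] mean[of j] by eventually_elim simp
    then have "AE w in M. ?ce (\<lambda>v. (?Z v $ i - ?ce (\<lambda>u. ?Z u $ i) v) * (?Z v $ j - ?ce (\<lambda>u. ?Z u $ j) v)) w
        = ?ce (\<lambda>w. g (Y w) $ i * g (Y w) $ j) w"
      by (rule real_cond_exp_cong) measurable
    moreover have "AE w in M. ?ce (\<lambda>w. g (Y w) $ i * g (Y w) $ j) w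
        = expectation (\<lambda>w. g (Y w) $ i * g (Y w) $ j)"
      by (rule real_cond_exp_indep[OF indep, of "\<lambda>y. g y $ i * g y $ j", OF _ gg]) measurable
    ultimately show ?thesis
      by eventually_elim simp
  qed
  \<comment> \<open>The exceptional null sets depend on \<open>i\<close> and \<open>j\<close>, of
    which there are finitely many.\<close>
  then have "AE w in M. \<forall>i j. ?ce (\<lambda>v. (?Z v $ i - ?ce (\<lambda>u. ?Z u $ i) v) * (?Z v $ j - ?ce (\<lambda>u. ?Z u $ j) v)) w
      = expectation (\<lambda>w. g (Y w) $ i * g (Y w) $ j)"
    by (simp add: AE_all_countable)
  then show ?thesis
    by eventually_elim (simp add: cond_cov_given_def cond_cov_def vec_eq_iff)
qed

text \<open>At most one of the positive and negative parts of \<open>c\<close> is nonzero, so the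
  difference is well behaved even for infinite \<open>c\<close>, in particular for a singular
  covariance.\<close>

lemma (in prob_space) ereal_expectation_AE_const:
  assumes "AE w in M. f w = c"
  shows "ereal_expectation M f = c"
proof -
  have "(\<integral>\<^sup>+ w. e2ennreal (f w) \<partial>M) = (\<integral>\<^sup>+ w. e2ennreal c \<partial>M)"
    "(\<integral>\<^sup>+ w. e2ennreal (- f w) \<partial>M) = (\<integral>\<^sup>+ w. e2ennreal (- c) \<partial>M)"
    by (rule nn_integral_cong_AE, use assms in eventually_elim, simp)+
  then have "ereal_expectation M f = enn2ereal (e2ennreal c) - enn2ereal (e2ennreal (- c))"
    by (simp add: ereal_expectation_def emeasure_space_1)
  also have "\<dots> = c"
  proof (cases "0 \<le> c")
    case True
    then have "e2ennreal (- c) = 0"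
      by (simp add: e2ennreal_neg)
    then show ?thesis
      using True by (simp add: enn2ereal_e2ennreal zero_ennreal.rep_eq)
  next
    case False
    then have "e2ennreal c = 0" "0 \<le> - c"
      by (simp_all add: e2ennreal_neg)
    then show ?thesis
      by (simp add: enn2ereal_e2ennreal zero_ennreal.rep_eq)
  qed
  finally show ?thesis .
qed

lemma log_ereal_mono: "r \<le> s \<Longrightarrow> log_ereal r \<le> log_ereal s"
  by (simp add: log_ereal_def)

section \<open>The optimization problem\<close>

lemma expected_log_det_cov_eq:
  fixes S M C D :: "real^'n^'n"
  assumes init: "initial_state S M P x0 p0" and S: "sym_pos_def S" and M: "sym_pos_def M"
    and position: "\<And>a b. position_at S M T a b = D *v a + C *v b"
  shows "expected_log_det_cov S M T P x0 p0 = log_ereal (det (C ** M ** transpose C))"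
proof -
  have x0: "gaussian_rv P S x0" and p0: "gaussian_rv P M p0" and P: "prob_space P"
    and indep: "prob_space.indep_var P borel x0 borel p0"
    using init by (simp_all add: initial_state_def)
  interpret prob_space P by fact
  \<comment> \<open>Entries become values of the form of \<open>M\<close> on rows of
    \<open>C\<close>, which are the mixed moments in \<open>gaussian_moments\<close>.\<close>
  have "(C ** M ** transpose C) $ i $ j = C $ i \<bullet> (M *v C $ j)" for i j
  proof -
    have "(C ** M ** transpose C) $ i $ j = ((C ** M ** transpose C) *v axis j 1) $ i"
      by (simp add: matrix_vector_mult_basis column_def)
    also have "\<dots> = (C *v (M *v (transpose C *v axis j 1))) $ i"
      by (simp only: matrix_vector_mul_assoc matrix_mul_assoc)
    also have "transpose C *v axis j 1 = C $ j"
      by (simp add: matrix_vector_mult_basis column_def transpose_def vec_eq_iff)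
    finally show ?thesis
      by (simp add: matrix_vector_mul_component)
  qed
  then have "(\<chi> i j. expectation (\<lambda>w. (C *v p0 w) $ i * (C *v p0 w) $ j)) = C ** M ** transpose C"
    by (simp add: vec_eq_iff matrix_vector_mul_component gaussian_moments[OF P p0 M])
  moreover have "AE w in P. cond_cov_given P (\<lambda>w. D *v x0 w + C *v p0 w) x0 w =
      (\<chi> i j. expectation (\<lambda>w. (C *v p0 w) $ i * (C *v p0 w) $ j))"
  proof (rule cond_cov_given_indep_add[OF indep])
    show "(*v) D \<in> borel_measurable borel" "(*v) C \<in> borel_measurable borel"
      by (intro borel_measurable_continuous_onI linear_continuous_on matrix_vector_mul_bounded_linear)+
  qed (simp_all add: matrix_vector_mul_component gaussian_moments[OF P x0 S] gaussian_moments[OF P p0 M])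
  ultimately have "AE w in P. cond_cov_given P (\<lambda>w. D *v x0 w + C *v p0 w) x0 w = C ** M ** transpose C"
    by simp
  then have "AE w in P. log_ereal (det (cond_cov_given P (\<lambda>v. position_at S M T (x0 v) (p0 v)) x0 w)) =
      log_ereal (det (C ** M ** transpose C))"
    unfolding position by eventually_elim simp
  then show ?thesis
    unfolding expected_log_det_cov_def by (rule ereal_expectation_AE_const)
qed

lemma expected_log_det_cov_le:
  fixes S M :: "real^'n^'n"
  assumes init: "initial_state S M P x0 p0" and S: "sym_pos_def S" and M: "sym_pos_def M"
  shows "expected_log_det_cov S M T P x0 p0 \<le> log_ereal (det S)"
proof -
  obtain C D where position: "\<And>a b. position_at S M T a b = D *v a + C *v b"
    and C: "\<And>b. (C *v b) \<bullet> (matrix_inv S *v (C *v b)) \<le> b \<bullet> (matrix_inv M *v b)"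
    by (rule position_at_decomposition[OF S M, where T = T]) blast
  have "det M * det C * det (matrix_inv S) * det C \<le> 1"
    using det_sandwich_le[OF sym_pos_def_matrix_inv[OF S] sym_pos_def_matrix_inv[OF M] C]
    by (simp add: matrix_inv_matrix_inv_sym_pos_def[OF M])
  \<comment> \<open>Multiplication by \<open>det S\<close> cancels the determinant of its inverse
    and leaves that of \<open>C ** M ** transpose C\<close>.\<close>
  then have "det S * (det M * det C * det (matrix_inv S) * det C) \<le> det S * 1"
    using sym_pos_def_det_pos[OF S] by (intro mult_left_mono) simp_all
  moreover have "det S * det (matrix_inv S) = 1"
    using sym_pos_def_mult_inv(1)[OF S] by (metis det_I det_mul)
  then have "det S * (det M * det C * det (matrix_inv S) * det C) = det (C ** M ** transpose C)"
    by (simp add: det_mul det_transpose algebra_simps)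
  ultimately have "det (C ** M ** transpose C) \<le> det S"
    by simp
  then show ?thesis
    by (simp add: expected_log_det_cov_eq[OF init S M position] log_ereal_mono)
qed

lemma expected_log_det_cov_matrix_inv:
  fixes S :: "real^'n^'n"
  assumes init: "initial_state S (matrix_inv S) P x0 p0" and S: "sym_pos_def S"
    and T: "(sin T)\<^sup>2 = 1"
  shows "expected_log_det_cov S (matrix_inv S) T P x0 p0 = log_ereal (det S)"
proof -
  have "position_at S (matrix_inv S) T a b = (cos T *\<^sub>R mat 1) *v a + (sin T *\<^sub>R S) *v b" for a b
    by (simp add: position_at_matrix_inv[OF S] scaleR_matrix_vector_assoc[symmetric])
  note eq = expected_log_det_cov_eq[OF init S sym_pos_def_matrix_inv[OF S] this]
  have "transpose (sin T *\<^sub>R S) = sin T *\<^sub>R S"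
    using S by (simp add: sym_pos_def_def transpose_scalar)
  moreover have "sin T * sin T = 1"
    using T by (simp add: power2_eq_square)
  ultimately have "(sin T *\<^sub>R S) ** matrix_inv S ** transpose (sin T *\<^sub>R S) = S"
    by (simp add: S flip: scalar_matrix_assoc matrix_scalar_ac)
  then show ?thesis
    using eq by simp
qed

text \<open>The probability space and the initial variables are families indexed by
  \<open>M\<close>, because the law of the momentum changes with \<open>M\<close>; the maximum holds
  for every such choice.\<close>

theorem theorem2p1:
  fixes \<Sigma> :: "real^'n^'n"
    and P :: "real^'n^'n \<Rightarrow> 'w measure"
    and x0 p0 :: "real^'n^'n \<Rightarrow> 'w \<Rightarrow> real^'n"
    and m :: nat
  assumes "sym_pos_def \<Sigma>"
    and "\<And>M. M \<in> commuting_spd \<Sigma> \<Longrightarrow> initial_state \<Sigma> M (P M) (x0 M) (p0 M)"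
  shows "is_arg_max
           (\<lambda>(M, T). expected_log_det_cov \<Sigma> M T (P M) (x0 M) (p0 M))
           (\<lambda>(M, T). M \<in> commuting_spd \<Sigma> \<and> 0 < T)
           (matrix_inv \<Sigma>, (2 * real m + 1) * pi / 2)"
proof -
  define T where "T = (2 * real m + 1) * pi / 2"
  have "T = pi / 2 + real m * pi"
    by (simp add: T_def field_simps)
  \<comment> \<open>\<open>sin T\<close> equals \<open>cos (real m * pi)\<close>, that is
    \<open>(-1) ^ m\<close>; squaring removes the parity of \<open>m\<close>.\<close>
  then have "(sin T)\<^sup>2 = 1"
    by (simp add: sin_add power_mult[symmetric])
  then have "expected_log_det_cov \<Sigma> (matrix_inv \<Sigma>) T (P (matrix_inv \<Sigma>)) (x0 (matrix_inv \<Sigma>))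
      (p0 (matrix_inv \<Sigma>)) = log_ereal (det \<Sigma>)"
    using assms matrix_inv_mem_commuting_spd by (intro expected_log_det_cov_matrix_inv) auto
  moreover have "expected_log_det_cov \<Sigma> M t (P M) (x0 M) (p0 M) \<le> log_ereal (det \<Sigma>)"
    if "M \<in> commuting_spd \<Sigma>" for M t
    using that assms by (intro expected_log_det_cov_le) (auto simp: commuting_spd_def)
  moreover have "0 < T"
    by (simp add: T_def)
  ultimately show ?thesis
    unfolding T_def[symmetric]
    using matrix_inv_mem_commuting_spd[OF assms(1)] by (auto simp: is_arg_max_def not_less)
qed

end
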